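(* (Invariance Theorem.) Let $\mathbb{P}$ be a constructive projective plane satisfying Desargues's Theorem (as axiomatized in the context; the underlying logic is intuitionistic), such that at least eight distinct lines pass through any given point. Let $A$ and $B$ be distinct points and let $C$ be any point on the line $AB$. Let $(l,R)$ and $(l',R')$ be two selections of auxiliary elements for the harmonic conjugate construction for $C$ with respect to $A,B$; that is, $l$ and $l'$ are lines through $C$, each distinct from $AB$, $R$ is a point lying outside each of the lines $AB$ and $l$, and $R'$ is a point lying outside each of the lines $AB$ and $l'$. Set $P=BR\cdot l$, $Q=AR\cdot l$, $S=AP\cdot BQ$, $D=AB\cdot RS$, and $P'=BR'\cdot l'$, $Q'=AR'\cdot l'$, $S'=AP'\cdot BQ'$, $D'=AB\cdot R'S'$. Then $D=D'$; that is, the harmonic conjugate construction is independent of the choice of auxiliary elements.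
   Context: Setting: constructive mathematics in the sense of Bishop (intuitionistic logic; the Law of Excluded Middle is not assumed). The plane $\mathbb{P}$ consists of a set of points and a set of lines with an incidence relation $P\in l$ ("$P$ lies on $l$", "$l$ passes through $P$"). Inequality: points, and likewise lines, carry an inequality relation $\neq$ ("distinct") that respects equality and satisfies: $\neg(x\neq x)$; symmetry; cotransitivity (if $x\neq y$, then for any $z$ either $z\neq x$ or $z\neq y$); and tightness (if $\neg(x\neq y)$, then $x=y$). Outside relation: $P\notin l$ ("$P$ lies outside $l$", "$l$ avoids $P$") is used in the affirmative sense: $P\neq Q$ for every point $Q$ lying on $l$. Axioms: C1. There exist a point $P$ and a line $l$ with $P\notin l$. C2. If $P$ and $Q$ are distinct points, there is a unique line, denoted $PQ$, passing through both. C3. If $l$ and $m$ are distinct lines, there is a unique point, denoted $l\cdot m$, lying on both. C4. At least three (pairwise) distinct points lie on any given line. C5. If there exists a point $P$ with $P\in l$ and $P\notin m$, then $l\neq m$. C6. If $\neg(P\notin l)$, then $P\in l$. C7. If $l$ and $m$ are distinct lines and $P$ is a point with $P\neq l\cdot m$, then either $P\notin l$ or $P\notin m$. Desargues's Theorem (adopted as an axiom). If distinct triangles are perspective from a center, then they are perspective from an axis. Terminology for the last axiom: a triangle is given by three noncollinear points (its vertices: pairwise distinct points, each lying outside the line joining the other two), and its sides are the three lines joining pairs of vertices. Two triangles (with vertices in given correspondence) are distinct if corresponding vertices are distinct and corresponding sides are distinct. Distinct triangles are perspective from the center $O$ if the lines joining corresponding vertices are concurrent at the point $O$, and $O$ lies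 outside each of the (six) sides; they are perspective from the axis $l$ if the points of intersection of corresponding sides are collinear on the line $l$, and $l$ avoids each of the (six) vertices. Harmonic conjugate construction: given distinct points $A,B$ and any point $C\in AB$ (it is not assumed to be decidable whether $C$ equals $A$ or $B$), select a line $l$ through $C$ with $l\neq AB$, and a point $R$ with $R\notin AB$ and $R\notin l$. Put $P=BR\cdot l$, $Q=AR\cdot l$, $S=AP\cdot BQ$, and $D=AB\cdot RS$. All the lines and intersection points used are well defined under these hypotheses. The point $D$ is the harmonic conjugate of $C$ with respect to $A,B$ constructed from the auxiliary elements $(l,R)$. *)

theory Defs
  imports Main
begin

text \<open>
  HOL is classical, so a constructive theorem is rendered here as derivability in intuitionistic
  logic. The language is two-sorted first-order logic with equality (points and lines),
  the primitive inequality of each sort, and incidence. Formulas are locally nameless: free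
  variables are names, bound variables are de Bruijn indices. The two sorts of variables are
  separate name spaces (the sort is determined by the position in an atomic formula), whereas all
  quantifiers share one index space. There are no function symbols: joining a pair of points is a
  partial operation (defined for distinct points only), so \<open>m = PQ\<close> is expressed by incidences.
\<close>

datatype sort = Pt | Ln

datatype tm = Fr string | Bd nat

datatype fm =
    Falsum
  | Eq sort tm tm
  | Neq sort tm tm
  | Inc tm tm
  | Conj fm fm
  | Disj fm fm
  | Imp fm fm
  | All sort fm
  | Ex sort fm

primrec names_tm :: "sort \<Rightarrow> tm \<Rightarrow> (sort \<times> string) set" where
  "names_tm s (Fr x) = {(s, x)}"
| "names_tm s (Bd k) = {}"

primrec names :: "fm \<Rightarrow> (sort \<times> string) set" where
  "names Falsum = {}"
| "names (Eq s t u) = names_tm s t \<union> names_tm s u"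
| "names (Neq s t u) = names_tm s t \<union> names_tm s u"
| "names (Inc t u) = names_tm Pt t \<union> names_tm Ln u"
| "names (Conj p q) = names p \<union> names q"
| "names (Disj p q) = names p \<union> names q"
| "names (Imp p q) = names p \<union> names q"
| "names (All s p) = names p"
| "names (Ex s p) = names p"

text \<open>The first argument of the map is the number of quantifiers above the occurrence, the second
  one its sort.\<close>

primrec map_tms :: "(nat \<Rightarrow> sort \<Rightarrow> tm \<Rightarrow> tm) \<Rightarrow> nat \<Rightarrow> fm \<Rightarrow> fm" where
  "map_tms f k Falsum = Falsum"
| "map_tms f k (Eq s t u) = Eq s (f k s t) (f k s u)"
| "map_tms f k (Neq s t u) = Neq s (f k s t) (f k s u)"
| "map_tms f k (Inc t u) = Inc (f k Pt t) (f k Ln u)"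
| "map_tms f k (Conj p q) = Conj (map_tms f k p) (map_tms f k q)"
| "map_tms f k (Disj p q) = Disj (map_tms f k p) (map_tms f k q)"
| "map_tms f k (Imp p q) = Imp (map_tms f k p) (map_tms f k q)"
| "map_tms f k (All s p) = All s (map_tms f (Suc k) p)"
| "map_tms f k (Ex s p) = Ex s (map_tms f (Suc k) p)"

text \<open>\<open>inst s x p\<close> is the instance of the body \<open>p\<close> of a quantifier of sort \<open>s\<close> at the variable \<open>x\<close>;
  \<open>bind_name s x p\<close> turns the free variable \<open>x\<close> of \<open>p\<close> into the bound variable of an
  additional outermost quantifier of sort \<open>s\<close>.\<close>

definition inst :: "sort \<Rightarrow> string \<Rightarrow> fm \<Rightarrow> fm" where
  "inst s x p = map_tms (\<lambda>k s' t. if s' = s \<and> t = Bd k then Fr x else t) 0 p"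

definition bind_name :: "sort \<Rightarrow> string \<Rightarrow> fm \<Rightarrow> fm" where
  "bind_name s x p = map_tms (\<lambda>k s' t. if s' = s \<and> t = Fr x then Bd k else t) 0 p"

text \<open>Natural deduction for intuitionistic logic with equality. Rule \<open>EqE\<close> makes inequality and
  incidence respect equality. A dangling index is never captured by a rule, so it acts as a
  constant and formulas need not be restricted to the locally closed ones.\<close>

inductive deriv :: "fm set \<Rightarrow> fm \<Rightarrow> bool" (infix "\<turnstile>" 20) where
  Asm: "p \<in> G \<Longrightarrow> G \<turnstile> p"
| FalsumE: "G \<turnstile> Falsum \<Longrightarrow> G \<turnstile> p"
| ConjI: "G \<turnstile> p \<Longrightarrow> G \<turnstile> q \<Longrightarrow> G \<turnstile> Conj p q"
| ConjE1: "G \<turnstile> Conj p q \<Longrightarrow> G \<turnstile> p"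
| ConjE2: "G \<turnstile> Conj p q \<Longrightarrow> G \<turnstile> q"
| DisjI1: "G \<turnstile> p \<Longrightarrow> G \<turnstile> Disj p q"
| DisjI2: "G \<turnstile> q \<Longrightarrow> G \<turnstile> Disj p q"
| DisjE: "G \<turnstile> Disj p q \<Longrightarrow> insert p G \<turnstile> r \<Longrightarrow> insert q G \<turnstile> r \<Longrightarrow> G \<turnstile> r"
| ImpI: "insert p G \<turnstile> q \<Longrightarrow> G \<turnstile> Imp p q"
| ImpE: "G \<turnstile> Imp p q \<Longrightarrow> G \<turnstile> p \<Longrightarrow> G \<turnstile> q"
| AllI: "G \<turnstile> inst s x p \<Longrightarrow> (s, x) \<notin> \<Union> (names ` G) \<union> names p \<Longrightarrow> G \<turnstile> All s p"
| AllE: "G \<turnstile> All s p \<Longrightarrow> G \<turnstile> inst s x p"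
| ExI: "G \<turnstile> inst s x p \<Longrightarrow> G \<turnstile> Ex s p"
| ExE: "G \<turnstile> Ex s p \<Longrightarrow> insert (inst s x p) G \<turnstile> q \<Longrightarrow>
    (s, x) \<notin> \<Union> (names ` G) \<union> names p \<union> names q \<Longrightarrow> G \<turnstile> q"
| EqI: "G \<turnstile> Eq s t t"
| EqE: "G \<turnstile> Eq s (Fr x) (Fr y) \<Longrightarrow> G \<turnstile> inst s x p \<Longrightarrow> G \<turnstile> inst s y p"

text \<open>Formulas are written with named variables, \<open>bind_name\<close> providing the quantifiers.\<close>

abbreviation Imp_syntax :: "fm \<Rightarrow> fm \<Rightarrow> fm" (infixr "\<^bold>\<longrightarrow>" 25) where "p \<^bold>\<longrightarrow> q \<equiv> Imp p q"
abbreviation Disj_syntax :: "fm \<Rightarrow> fm \<Rightarrow> fm" (infixr "\<^bold>\<or>" 30) where "p \<^bold>\<or> q \<equiv> Disj p q"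
abbreviation Conj_syntax :: "fm \<Rightarrow> fm \<Rightarrow> fm" (infixr "\<^bold>\<and>" 35) where "p \<^bold>\<and> q \<equiv> Conj p q"
abbreviation Not_syntax :: "fm \<Rightarrow> fm" ("\<^bold>\<not> _" [40] 40) where "\<^bold>\<not> p \<equiv> Imp p Falsum"

abbreviation eq_syntax :: "string \<Rightarrow> sort \<Rightarrow> string \<Rightarrow> fm" ("_ \<^bold>=[_] _" [51, 0, 51] 50) where
  "x \<^bold>=[s] y \<equiv> Eq s (Fr x) (Fr y)"
abbreviation neq_syntax :: "string \<Rightarrow> sort \<Rightarrow> string \<Rightarrow> fm" ("_ \<^bold>\<noteq>[_] _" [51, 0, 51] 50) where
  "x \<^bold>\<noteq>[s] y \<equiv> Neq s (Fr x) (Fr y)"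
abbreviation on_syntax :: "string \<Rightarrow> string \<Rightarrow> fm" (infix "\<^bold>\<in>" 50) where
  "P \<^bold>\<in> l \<equiv> Inc (Fr P) (Fr l)"

definition all_names :: "sort \<Rightarrow> string list \<Rightarrow> fm \<Rightarrow> fm" ("\<^bold>\<forall>[_] _./ _" [0, 51, 10] 10) where
  "all_names s xs p = foldr (\<lambda>x q. All s (bind_name s x q)) xs p"

definition ex_names :: "sort \<Rightarrow> string list \<Rightarrow> fm \<Rightarrow> fm" ("\<^bold>\<exists>[_] _./ _" [0, 51, 10] 10) where
  "ex_names s xs p = foldr (\<lambda>x q. Ex s (bind_name s x q)) xs p"

fun conjs :: "fm list \<Rightarrow> fm" where
  "conjs [] = (Falsum \<^bold>\<longrightarrow> Falsum)"
| "conjs [p] = p"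
| "conjs (p # ps) = (p \<^bold>\<and> conjs ps)"

fun pairwise_distinct :: "sort \<Rightarrow> string list \<Rightarrow> fm" where
  "pairwise_distinct s [] = conjs []"
| "pairwise_distinct s [x] = conjs []"
| "pairwise_distinct s (x # xs) = (conjs (map (\<lambda>y. x \<^bold>\<noteq>[s] y) xs) \<^bold>\<and> pairwise_distinct s xs)"

text \<open>\<open>P\<close> lies outside \<open>l\<close>: it is distinct from every point of \<open>l\<close>.\<close>

definition outside :: "string \<Rightarrow> string \<Rightarrow> fm" (infix "\<^bold>\<notin>" 50) where
  "P \<^bold>\<notin> l = All Pt (Imp (Inc (Bd 0) (Fr l)) (Neq Pt (Fr P) (Bd 0)))"

text \<open>\<open>m = PQ\<close> and \<open>X = l \<cdot> m\<close>. These are only used where the two points (lines) are distinct.\<close>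

definition joins :: "string \<Rightarrow> string \<Rightarrow> string \<Rightarrow> fm" where
  "joins m P Q = (P \<^bold>\<in> m \<^bold>\<and> Q \<^bold>\<in> m)"

definition meets :: "string \<Rightarrow> string \<Rightarrow> string \<Rightarrow> fm" where
  "meets X l m = (X \<^bold>\<in> l \<^bold>\<and> X \<^bold>\<in> m)"

definition inequality_axioms :: "sort \<Rightarrow> fm set" where
  "inequality_axioms s =
    {\<^bold>\<forall>[s] [''x'']. \<^bold>\<not> (''x'' \<^bold>\<noteq>[s] ''x''),
     \<^bold>\<forall>[s] [''x'', ''y'']. ''x'' \<^bold>\<noteq>[s] ''y'' \<^bold>\<longrightarrow> ''y'' \<^bold>\<noteq>[s] ''x'',
     \<^bold>\<forall>[s] [''x'', ''y'', ''z'']. ''x'' \<^bold>\<noteq>[s] ''y'' \<^bold>\<longrightarrow> ''z'' \<^bold>\<noteq>[s] ''x'' \<^bold>\<or> ''z'' \<^bold>\<noteq>[s] ''y'',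
     \<^bold>\<forall>[s] [''x'', ''y'']. \<^bold>\<not> (''x'' \<^bold>\<noteq>[s] ''y'') \<^bold>\<longrightarrow> ''x'' \<^bold>=[s] ''y''}"

definition C1 :: fm where
  "C1 = (\<^bold>\<exists>[Pt] [''P'']. \<^bold>\<exists>[Ln] [''l'']. ''P'' \<^bold>\<notin> ''l'')"

definition C2 :: fm where
  "C2 = (\<^bold>\<forall>[Pt] [''P'', ''Q'']. ''P'' \<^bold>\<noteq>[Pt] ''Q'' \<^bold>\<longrightarrow>
    (\<^bold>\<exists>[Ln] [''l'']. joins ''l'' ''P'' ''Q'' \<^bold>\<and>
      (\<^bold>\<forall>[Ln] [''m'']. joins ''m'' ''P'' ''Q'' \<^bold>\<longrightarrow> ''m'' \<^bold>=[Ln] ''l'')))"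

definition C3 :: fm where
  "C3 = (\<^bold>\<forall>[Ln] [''l'', ''m'']. ''l'' \<^bold>\<noteq>[Ln] ''m'' \<^bold>\<longrightarrow>
    (\<^bold>\<exists>[Pt] [''P'']. meets ''P'' ''l'' ''m'' \<^bold>\<and>
      (\<^bold>\<forall>[Pt] [''Q'']. meets ''Q'' ''l'' ''m'' \<^bold>\<longrightarrow> ''Q'' \<^bold>=[Pt] ''P'')))"

definition C4 :: fm where
  "C4 = (\<^bold>\<forall>[Ln] [''l'']. \<^bold>\<exists>[Pt] [''P'', ''Q'', ''R''].
    pairwise_distinct Pt [''P'', ''Q'', ''R''] \<^bold>\<and> ''P'' \<^bold>\<in> ''l'' \<^bold>\<and> ''Q'' \<^bold>\<in> ''l'' \<^bold>\<and> ''R'' \<^bold>\<in> ''l'')"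

definition C5 :: fm where
  "C5 = (\<^bold>\<forall>[Ln] [''l'', ''m''].
    (\<^bold>\<exists>[Pt] [''P'']. ''P'' \<^bold>\<in> ''l'' \<^bold>\<and> ''P'' \<^bold>\<notin> ''m'') \<^bold>\<longrightarrow> ''l'' \<^bold>\<noteq>[Ln] ''m'')"

definition C6 :: fm where
  "C6 = (\<^bold>\<forall>[Pt] [''P'']. \<^bold>\<forall>[Ln] [''l'']. \<^bold>\<not> (''P'' \<^bold>\<notin> ''l'') \<^bold>\<longrightarrow> ''P'' \<^bold>\<in> ''l'')"

definition C7 :: fm where
  "C7 = (\<^bold>\<forall>[Ln] [''l'', ''m'']. \<^bold>\<forall>[Pt] [''P'', ''X''].
    ''l'' \<^bold>\<noteq>[Ln] ''m'' \<^bold>\<and> meets ''X'' ''l'' ''m'' \<^bold>\<and> ''P'' \<^bold>\<noteq>[Pt] ''X'' \<^bold>\<longrightarrow> ''P'' \<^bold>\<notin> ''l'' \<^bold>\<or> ''P'' \<^bold>\<notin> ''m'')"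

text \<open>Vertices \<open>A\<close>, \<open>B\<close>, \<open>C\<close> and the respective opposite sides \<open>a\<close>, \<open>b\<close>, \<open>c\<close>.\<close>

definition triangle ::
    "string \<Rightarrow> string \<Rightarrow> string \<Rightarrow> string \<Rightarrow> string \<Rightarrow> string \<Rightarrow> fm" where
  "triangle A B C a b c = conjs
    [pairwise_distinct Pt [A, B, C], joins a B C, joins b C A, joins c A B,
     A \<^bold>\<notin> a, B \<^bold>\<notin> b, C \<^bold>\<notin> c]"

definition Desargues :: fm where
  "Desargues =
    (\<^bold>\<forall>[Pt] [''A1'', ''B1'', ''C1'', ''A2'', ''B2'', ''C2'', ''O''].
     \<^bold>\<forall>[Ln] [''a1'', ''b1'', ''c1'', ''a2'', ''b2'', ''c2'', ''u'', ''v'', ''w''].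
      conjs
       [triangle ''A1'' ''B1'' ''C1'' ''a1'' ''b1'' ''c1'',
        triangle ''A2'' ''B2'' ''C2'' ''a2'' ''b2'' ''c2'',
        ''A1'' \<^bold>\<noteq>[Pt] ''A2'', ''B1'' \<^bold>\<noteq>[Pt] ''B2'', ''C1'' \<^bold>\<noteq>[Pt] ''C2'',
        ''a1'' \<^bold>\<noteq>[Ln] ''a2'', ''b1'' \<^bold>\<noteq>[Ln] ''b2'', ''c1'' \<^bold>\<noteq>[Ln] ''c2'',
        joins ''u'' ''A1'' ''A2'', joins ''v'' ''B1'' ''B2'', joins ''w'' ''C1'' ''C2'',
        ''O'' \<^bold>\<in> ''u'', ''O'' \<^bold>\<in> ''v'', ''O'' \<^bold>\<in> ''w'',
        ''O'' \<^bold>\<notin> ''a1'', ''O'' \<^bold>\<notin> ''b1'', ''O'' \<^bold>\<notin> ''c1'',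
        ''O'' \<^bold>\<notin> ''a2'', ''O'' \<^bold>\<notin> ''b2'', ''O'' \<^bold>\<notin> ''c2'']
      \<^bold>\<longrightarrow>
      (\<^bold>\<exists>[Ln] [''l'']. \<^bold>\<exists>[Pt] [''X'', ''Y'', ''Z'']. conjs
       [meets ''X'' ''a1'' ''a2'', meets ''Y'' ''b1'' ''b2'', meets ''Z'' ''c1'' ''c2'',
        ''X'' \<^bold>\<in> ''l'', ''Y'' \<^bold>\<in> ''l'', ''Z'' \<^bold>\<in> ''l'',
        ''A1'' \<^bold>\<notin> ''l'', ''B1'' \<^bold>\<notin> ''l'', ''C1'' \<^bold>\<notin> ''l'',
        ''A2'' \<^bold>\<notin> ''l'', ''B2'' \<^bold>\<notin> ''l'', ''C2'' \<^bold>\<notin> ''l'']))"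

definition Desarguesian_plane :: "fm set" where
  "Desarguesian_plane =
    inequality_axioms Pt \<union> inequality_axioms Ln \<union> {C1, C2, C3, C4, C5, C6, C7, Desargues}"

definition eight_lines_through_each_point :: fm where
  "eight_lines_through_each_point =
    (\<^bold>\<forall>[Pt] [''P'']. \<^bold>\<exists>[Ln] [''l1'', ''l2'', ''l3'', ''l4'', ''l5'', ''l6'', ''l7'', ''l8''].
      pairwise_distinct Ln [''l1'', ''l2'', ''l3'', ''l4'', ''l5'', ''l6'', ''l7'', ''l8''] \<^bold>\<and>
      conjs (map (\<lambda>l. ''P'' \<^bold>\<in> l)
        [''l1'', ''l2'', ''l3'', ''l4'', ''l5'', ''l6'', ''l7'', ''l8'']))"

text \<open>Auxiliary elements \<open>(l, R)\<close> for \<open>C\<close> with respect to \<open>A\<close>, \<open>B\<close>, where \<open>ab\<close> is the line \<open>AB\<close>.\<close>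

definition auxiliary :: "string \<Rightarrow> string \<Rightarrow> string \<Rightarrow> string \<Rightarrow> fm" where
  "auxiliary ab C l R = conjs [C \<^bold>\<in> l, l \<^bold>\<noteq>[Ln] ab, R \<^bold>\<notin> ab, R \<^bold>\<notin> l]"

text \<open>\<open>D\<close> is obtained from \<open>(l, R)\<close> through the lines \<open>br = BR\<close>, \<open>ar = AR\<close>, \<open>ap = AP\<close>, \<open>bq = BQ\<close>,
  \<open>rs = RS\<close> and the points \<open>P\<close>, \<open>Q\<close>, \<open>S\<close>.\<close>

definition harmonic_construction ::
    "string \<Rightarrow> string \<Rightarrow> string \<Rightarrow> string \<Rightarrow> string \<Rightarrow>
     string \<Rightarrow> string \<Rightarrow> string \<Rightarrow> string \<Rightarrow> string \<Rightarrow>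
     string \<Rightarrow> string \<Rightarrow> string \<Rightarrow> string \<Rightarrow> fm" where
  "harmonic_construction A B ab l R br ar P Q ap bq S rs D = conjs
    [joins br B R, joins ar A R, meets P br l, meets Q ar l,
     joins ap A P, joins bq B Q, meets S ap bq, joins rs R S, meets D ab rs]"

end

theory Submission
  imports Defs "HOL-Library.Countable"
begin

text \<open>
  By tightness it suffices to refute \<open>D \<noteq> D'\<close>, and for a refutation the classical geometry of the
  plane is available. A finite set of formulas that does not derive \<open>Falsum\<close> extends to a set \<open>T\<close>
  that is closed under derivability, contains each formula or its negation, and has a witness for
  each of its existential formulas. Universal formulas missing from \<open>T\<close> need not have
  counterexamples, but tightness and C6 make \<open>\<noteq>\<close> and \<open>\<notin>\<close> in \<open>T\<close> the complements of \<open>=\<close> and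
  \<open>\<in>\<close>; the only negatively occurring universal formulas of the axioms are thereby decided, and the
  names modulo provable equality form a classical Desarguesian plane.

  There, if \<open>C\<close> is \<open>A\<close> or \<open>B\<close>, then \<open>D = C\<close>. Otherwise two special moves of the auxiliary elements
  preserve \<open>D\<close>, each by a single application of Desargues's theorem: changing \<open>l\<close> with \<open>R\<close> fixed
  (centre \<open>C\<close>), and moving \<open>R\<close> along \<open>AR\<close> with \<open>l\<close> fixed (centre \<open>Q\<close>), or symmetrically along \<open>BR\<close>.
  Any \<open>R\<close> reaches any \<open>R'\<close> through \<open>AR \<cdot> BR'\<close>, with a line through \<open>C\<close> that avoids all three points.
\<close>

section \<open>The harmonic conjugate in a classical Desarguesian plane\<close>

definition tri :: "('p \<Rightarrow> 'l \<Rightarrow> bool) \<Rightarrow> 'p \<Rightarrow> 'p \<Rightarrow> 'p \<Rightarrow> 'l \<Rightarrow> 'l \<Rightarrow> 'l \<Rightarrow> bool" where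
  "tri inc A B C a b c \<longleftrightarrow> A \<noteq> B \<and> A \<noteq> C \<and> B \<noteq> C \<and> inc B a \<and> inc C a \<and> inc C b \<and> inc A b \<and>
    inc A c \<and> inc B c \<and> \<not> inc A a \<and> \<not> inc B b \<and> \<not> inc C c"

text \<open>The types \<open>'p\<close> and \<open>'l\<close> may have elements that are neither
  points nor lines: in the later instance both are the type of all sets of names, where only
  equivalence classes are incident with anything. The incidence premises of \<open>join\<close>,
  \<open>meet\<close> and \<open>avoid_four_lines\<close> single out the genuine points and
  lines.\<close>

locale desarguesian =
  fixes inc :: "'p \<Rightarrow> 'l \<Rightarrow> bool"
  assumes unique: "\<lbrakk>inc P l; inc Q l; inc P m; inc Q m\<rbrakk> \<Longrightarrow> P = Q \<or> l = m"
    and join: "\<lbrakk>inc P l; inc Q m\<rbrakk> \<Longrightarrow> \<exists>k. inc P k \<and> inc Q k"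
    and meet: "\<lbrakk>inc P l; inc Q m\<rbrakk> \<Longrightarrow> \<exists>X. inc X l \<and> inc X m"
    and avoid_four_lines: "inc P l \<Longrightarrow> \<exists>m. inc P m \<and> m \<notin> {l1, l2, l3, l4}"
    and Desargues: "\<lbrakk>tri inc A B C a b c; tri inc A' B' C' a' b' c';
        A \<noteq> A'; B \<noteq> B'; C \<noteq> C'; a \<noteq> a'; b \<noteq> b'; c \<noteq> c';
        inc A u; inc A' u; inc B v; inc B' v; inc C w; inc C' w; inc V u; inc V v; inc V w;
        \<not> inc V a; \<not> inc V b; \<not> inc V c; \<not> inc V a'; \<not> inc V b'; \<not> inc V c'\<rbrakk> \<Longrightarrow>
      \<exists>k X Y Z. inc X a \<and> inc X a' \<and> inc Y b \<and> inc Y b' \<and> inc Z c \<and> inc Z c' \<and>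
        inc X k \<and> inc Y k \<and> inc Z k"
begin

text \<open>Corresponding sides are distinct and share at most one point, so the points supplied by
  the axiom coincide with any given intersection points.\<close>

lemma Desargues_collinear:
  assumes "tri inc A B C a b c" "tri inc A' B' C' a' b' c'"
    "A \<noteq> A'" "B \<noteq> B'" "C \<noteq> C'" and ne: "a \<noteq> a'" "b \<noteq> b'" "c \<noteq> c'"
    and "inc A u" "inc A' u" "inc B v" "inc B' v" "inc C w" "inc C' w" "inc V u" "inc V v" "inc V w"
    "\<not> inc V a" "\<not> inc V b" "\<not> inc V c" "\<not> inc V a'" "\<not> inc V b'" "\<not> inc V c'"
    and i: "inc X a" "inc X a'" "inc Y b" "inc Y b'" "inc Z c" "inc Z c'"
  shows "\<exists>k. inc X k \<and> inc Y k \<and> inc Z k"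
proof -
  obtain k X' Y' Z' where *: "inc X' a" "inc X' a'" "inc Y' b" "inc Y' b'" "inc Z' c" "inc Z' c'"
      "inc X' k" "inc Y' k" "inc Z' k"
    using Desargues[OF assms(1-23)] by blast
  have "X' = X" "Y' = Y" "Z' = Z"
    using unique * i ne by metis+
  then show ?thesis
    using * by blast
qed

definition harm where
  "harm A B C ab l R br ar P Q ap bq S rs D \<longleftrightarrow>
    A \<noteq> B \<and> inc A ab \<and> inc B ab \<and> inc C ab \<and> inc C l \<and> l \<noteq> ab \<and> \<not> inc R ab \<and> \<not> inc R l \<and>
    inc B br \<and> inc R br \<and> inc A ar \<and> inc R ar \<and> inc P br \<and> inc P l \<and> inc Q ar \<and> inc Q l \<and>
    inc A ap \<and> inc P ap \<and> inc B bq \<and> inc Q bq \<and> inc S ap \<and> inc S bq \<and>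
    inc R rs \<and> inc S rs \<and> inc D ab \<and> inc D rs"

text \<open>Transfers what is proved about \<open>A\<close> and the line \<open>AR\<close> to
  \<open>B\<close> and the line \<open>BR\<close>.\<close>

lemma harm_swap:
  "harm A B C ab l R br ar P Q ap bq S rs D \<Longrightarrow> harm B A C ab l R ar br Q P bq ap S rs D"
  unfolding harm_def by auto

text \<open>Here \<open>l\<close> passes through \<open>A\<close>, so \<open>Q = A\<close> and
  \<open>BQ = AB\<close>; also \<open>AP = l\<close>. Hence \<open>S = A\<close>, and
  \<open>RS\<close> meets \<open>AB\<close> in \<open>A\<close>.\<close>

lemma harm_degenerate:
  assumes "harm A B A ab l R br ar P Q ap bq S rs D"
  shows "D = A"
proof -
  note h = assms[unfolded harm_def]
  have "Q = A" using h unique by metis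
  moreover have "bq = ab" using h unique calculation by metis
  moreover have "P \<noteq> A" using h unique by metis
  moreover have "ap = l" using h unique calculation by metis
  moreover have "S = A" using h unique calculation by metis
  ultimately show ?thesis using h unique by metis
qed

text \<open>\<open>P\<close>, \<open>Q\<close>, \<open>R\<close>, \<open>S\<close> form a complete
  quadrangle with \<open>A\<close> and \<open>B\<close> among its diagonal points. These facts are
  the side conditions for the two applications of Desargues's theorem. They come in batches, each
  refuting incidences that would merge points or lines already separated.\<close>

lemma harm_nondegenerate:
  assumes "harm A B C ab l R br ar P Q ap bq S rs D" "C \<noteq> A" "C \<noteq> B"
  shows "\<not> inc A l" "\<not> inc B l" "\<not> inc A br" "\<not> inc B ar" "\<not> inc C br" "\<not> inc C ar"
    "\<not> inc P ab" "\<not> inc Q ab" "\<not> inc P ar" "\<not> inc Q br" "P \<noteq> Q" "P \<noteq> R" "Q \<noteq> R"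
    "\<not> inc B ap" "\<not> inc A bq" "\<not> inc C ap" "\<not> inc C bq" "\<not> inc Q ap" "\<not> inc P bq"
    "\<not> inc R ap" "\<not> inc R bq" "\<not> inc S ab" "\<not> inc S l" "\<not> inc S br" "\<not> inc S ar"
    "\<not> inc P rs" "\<not> inc Q rs" "\<not> inc A rs" "\<not> inc B rs"
proof -
  note h = assms[unfolded harm_def]
  show 1: "\<not> inc A l" "\<not> inc B l" "\<not> inc A br" "\<not> inc B ar" using h unique by metis+
  show 2: "\<not> inc C br" "\<not> inc C ar" using h 1 unique by metis+
  show 3: "\<not> inc P ab" "\<not> inc Q ab" using h 1 2 unique by metis+
  show 4: "P \<noteq> R" "Q \<noteq> R" using h by auto
  show 5: "\<not> inc P ar" "\<not> inc Q br" using h 1 4 unique by metis+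
  show "P \<noteq> Q" using h 5 by auto
  show 6: "\<not> inc B ap" "\<not> inc A bq" using h 1 3 unique by metis+
  show 7: "\<not> inc C ap" "\<not> inc C bq" using h 6 assms(2,3) unique by metis+
  show 8: "\<not> inc Q ap" "\<not> inc P bq" using h 3 5 unique by metis+
  show 9: "\<not> inc R ap" "\<not> inc R bq" using h 1 4 unique by metis+
  show 10: "\<not> inc S ab" using h 6 unique by metis
  show 11: "\<not> inc S l" using h 8 unique by metis
  show 12: "\<not> inc S br" "\<not> inc S ar" using h 6 9 5 8 unique by metis+
  show 13: "\<not> inc P rs" "\<not> inc Q rs" using h 4 12 unique by metis+
  show "\<not> inc A rs" "\<not> inc B rs" using h 12 unique by metis+
qed

text \<open>For \<open>l\<close> different from \<open>l'\<close>, the triangles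
  \<open>P P' A\<close> and \<open>Q Q' B\<close> are perspective from \<open>C\<close>. Their
  corresponding sides meet in \<open>S'\<close>, \<open>S\<close> and \<open>R\<close>, so
  \<open>RS\<close> and \<open>RS'\<close> are the same line.\<close>

lemma harm_change_line:
  assumes H: "harm A B C ab l R br ar P Q ap bq S rs D"
    and H': "harm A B C ab l' R br' ar' P' Q' ap' bq' S' rs' D'"
    and "C \<noteq> A" "C \<noteq> B"
  shows "D = D'"
proof (cases "l = l'")
  case True
  then show ?thesis using H H' unfolding harm_def using unique harm_nondegenerate[OF H] assms(3,4) by metis
next
  case False
  note h = H[unfolded harm_def] and h' = H'[unfolded harm_def]
  note n = harm_nondegenerate[OF H assms(3,4)] and n' = harm_nondegenerate[OF H' assms(3,4)]
  have e: "br' = br" "ar' = ar" using h h' unique by metis+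
  have ne: "P \<noteq> P'" "Q \<noteq> Q'" using h h' n False unique by metis+
  have ne': "ap \<noteq> ap'" "bq \<noteq> bq'" using h h' n n' e ne unique by metis+
  have "\<exists>k. inc S' k \<and> inc S k \<and> inc R k"
    apply (rule Desargues_collinear[where V = C and A = P and B = P' and C = A
      and A' = Q and B' = Q' and C' = B and u = l and v = l' and w = ab
      and a = ap' and b = ap and c = br and a' = bq' and b' = bq and c' = ar])
    using h h' n n' e ne ne' unfolding tri_def by (auto dest: unique)
  then obtain k where "inc S' k" "inc S k" "inc R k" by blast
  then have "rs = k" "rs' = k" using h h' n n' e unique by metis+
  then show ?thesis using h h' unique by metis
qed

text \<open>As \<open>R\<close> and \<open>R'\<close> lie on the same line through \<open>A\<close>,
  the constructions share \<open>Q\<close> and \<open>BQ\<close>. The triangles \<open>R P S\<close>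
  and \<open>R' P' S'\<close> are perspective from \<open>Q\<close>; their sides meet in
  \<open>A\<close>, in the point \<open>X\<close> of \<open>RS\<close> and \<open>R'S'\<close>, and
  in \<open>B\<close>. So \<open>X\<close> lies on \<open>AB\<close> and equals both
  \<open>D\<close> and \<open>D'\<close>.\<close>

lemma harm_change_point:
  assumes H: "harm A B C ab l R br ar P Q ap bq S rs D"
    and H': "harm A B C ab l R' br' ar P' Q' ap' bq' S' rs' D'"
    and "C \<noteq> A" "C \<noteq> B"
  shows "D = D'"
proof (cases "R = R'")
  case True
  then show ?thesis using harm_change_line[OF H _ assms(3,4)] H' by blast
next
  case False
  note h = H[unfolded harm_def] and h' = H'[unfolded harm_def]
  note n = harm_nondegenerate[OF H assms(3,4)] and n' = harm_nondegenerate[OF H' assms(3,4)]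
  have e: "Q' = Q" "bq' = bq" using h h' n n' unique by metis+
  have ne1: "br \<noteq> br'" using h h' n n' False unique by metis
  have ne2: "P \<noteq> P'" using h h' n n' ne1 unique by metis
  have ne3: "ap \<noteq> ap'" using h h' n n' ne2 unique by metis
  have ne4: "S \<noteq> S'" using h h' n n' ne3 unique by metis
  have ne5: "rs \<noteq> rs'" using h h' n n' False unique by metis
  obtain X where X: "inc X rs" "inc X rs'" using meet h h' by blast
  have "\<exists>k. inc A k \<and> inc X k \<and> inc B k"
    apply (rule Desargues_collinear[where V = Q and A = R and B = P and C = S
      and A' = R' and B' = P' and C' = S' and u = ar and v = l and w = bq
      and a = ap and b = rs and c = br and a' = ap' and b' = rs' and c' = br'])
    using h h' n n' e False ne1 ne2 ne3 ne4 ne5 X unfolding tri_def by auto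
  then have "inc X ab" using h unique by metis
  then show ?thesis using h h' n n' X unique by metis
qed

text \<open>The assumption \<open>inc R m\<close> records that \<open>R\<close> is a genuine point,
  as \<open>join\<close> requires.\<close>

lemma harm_exists:
  assumes "A \<noteq> B" "inc A ab" "inc B ab" "inc C ab" "inc C l" "l \<noteq> ab" "\<not> inc R ab" "\<not> inc R l" "inc R m"
  shows "\<exists>br ar P Q ap bq S rs D. harm A B C ab l R br ar P Q ap bq S rs D"
proof -
  obtain br where "inc B br" "inc R br" using join assms by blast
  moreover obtain ar where "inc A ar" "inc R ar" using join assms by blast
  moreover obtain P where "inc P br" "inc P l" using meet assms calculation by blast
  moreover obtain Q where "inc Q ar" "inc Q l" using meet assms calculation by blast
  moreover obtain ap where "inc A ap" "inc P ap" using join assms calculation by blast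
  moreover obtain bq where "inc B bq" "inc Q bq" using join assms calculation by blast
  moreover obtain S where "inc S ap" "inc S bq" using meet calculation by blast
  moreover obtain rs where "inc R rs" "inc S rs" using join calculation by blast
  moreover obtain D where "inc D ab" "inc D rs" using meet assms calculation by blast
  ultimately show ?thesis using assms unfolding harm_def by blast
qed

theorem harm_unique:
  assumes H: "harm A B C ab l R br ar P Q ap bq S rs D"
    and H': "harm A B C ab l' R' br' ar' P' Q' ap' bq' S' rs' D'"
  shows "D = D'"
proof (cases "C = A \<or> C = B")
  case True
  then show ?thesis using H H' harm_degenerate harm_swap by metis
next
  case False
  then have C: "C \<noteq> A" "C \<noteq> B" by auto
  note h = H[unfolded harm_def] and h' = H'[unfolded harm_def]
  obtain R2 where R2: "inc R2 ar" "inc R2 br'" using meet h h' by blast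
  have R2ab: "\<not> inc R2 ab" using h h' R2 unique by metis
  obtain k1 where k1: "inc C k1" "inc R k1" using join h by blast
  obtain k2 where k2: "inc C k2" "inc R2 k2" using join h R2 by blast
  obtain k3 where k3: "inc C k3" "inc R' k3" using join h h' by blast
  obtain m where m: "inc C m" "m \<noteq> ab" "m \<noteq> k1" "m \<noteq> k2" "m \<noteq> k3"
    using avoid_four_lines[of C l ab k1 k2 k3] h by auto
  \<comment> \<open>The three points lie off \<open>ab\<close>, so the line joining \<open>C\<close>
    to one of them is the corresponding \<open>k1\<close>, \<open>k2\<close> or \<open>k3\<close>;
    \<open>m\<close> differs from these.\<close>
  have out: "\<not> inc R m" "\<not> inc R2 m" "\<not> inc R' m"
    using unique m h h' R2ab k1 k2 k3 by metis+
  obtain br1 ar1 P1 Q1 ap1 bq1 S1 rs1 D1 where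
    1: "harm A B C ab m R br1 ar1 P1 Q1 ap1 bq1 S1 rs1 D1"
    using harm_exists[of A B ab C m R] h m out by blast
  obtain br2 ar2 P2 Q2 ap2 bq2 S2 rs2 D2 where
    2: "harm A B C ab m R2 br2 ar2 P2 Q2 ap2 bq2 S2 rs2 D2"
    using harm_exists[of A B ab C m R2] h m R2 R2ab out by blast
  obtain br3 ar3 P3 Q3 ap3 bq3 S3 rs3 D3 where
    3: "harm A B C ab m R' br3 ar3 P3 Q3 ap3 bq3 S3 rs3 D3"
    using harm_exists[of A B ab C m R'] h h' m out by blast
  \<comment> \<open>\<open>harm_change_point\<close> needs a common side: moving \<open>R\<close> to
    \<open>R2\<close> keeps \<open>ar\<close>, and moving \<open>R2\<close> to \<open>R'\<close>
    keeps \<open>br'\<close>, which the swapped form handles.\<close>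
  have e: "ar1 = ar" "ar2 = ar" "br2 = br'" "br3 = br'"
    using 1 2 3 h h' R2 R2ab unique unfolding harm_def by metis+
  have "D = D1" using harm_change_line[OF H 1 C] .
  also have "D1 = D2" using harm_change_point[OF 1[unfolded e] 2[unfolded e] C] .
  also have "D2 = D3"
    using harm_change_point[OF harm_swap[OF 2[unfolded e]] harm_swap[OF 3[unfolded e]] C(2,1)] .
  also have "D3 = D'" using harm_change_line[OF 3 H' C] .
  finally show ?thesis .
qed

end

section \<open>Renaming and weakening of derivations\<close>

text \<open>Countability lets \<open>from_nat\<close> run through all formulas when a complete
  theory is built.\<close>

instance sort :: countable by countable_datatype
instance tm :: countable by countable_datatype
instance fm :: countable by countable_datatype

definition ren :: "(sort \<Rightarrow> string \<Rightarrow> string) \<Rightarrow> fm \<Rightarrow> fm" where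
  "ren r = map_tms (\<lambda>_ s t. case t of Fr x \<Rightarrow> Fr (r s x) | Bd n \<Rightarrow> Bd n) 0"

lemma map_tms_map_tms:
  "map_tms f k (map_tms g k p) = map_tms (\<lambda>k s t. f k s (g k s t)) k p"
  by (induction p arbitrary: k) auto

lemma map_tms_cong:
  assumes "\<And>k s x. (s, x) \<in> names p \<Longrightarrow> f k s (Fr x) = g k s (Fr x)"
    and "\<And>k s n. f k s (Bd n) = g k s (Bd n)"
  shows "map_tms f k p = map_tms g k p"
proof -
  have tm: "f k s t = g k s t" if "names_tm s t \<subseteq> names p" for k s t
    using assms that by (cases t) auto
  have "names q \<subseteq> names p \<Longrightarrow> map_tms f k q = map_tms g k q" for q k
    by (induction q arbitrary: k) (auto intro!: tm)
  then show ?thesis by blast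
qed

lemma ren_simps [simp]:
  "ren r Falsum = Falsum"
  "ren r (Conj p q) = Conj (ren r p) (ren r q)"
  "ren r (Disj p q) = Disj (ren r p) (ren r q)"
  "ren r (Imp p q) = Imp (ren r p) (ren r q)"
  "ren r (Eq s (Fr x) (Fr y)) = Eq s (Fr (r s x)) (Fr (r s y))"
  by (simp_all add: ren_def)

lemma ren_Eq_refl: "\<exists>u. ren r (Eq s t t) = Eq s u u"
  by (simp add: ren_def)

lemma map_tms_depth_irrelevant: "map_tms (\<lambda>_. f) k p = map_tms (\<lambda>_. f) 0 p"
proof -
  have "map_tms (\<lambda>_. f) k p = map_tms (\<lambda>_. f) k' p" for k k'
    by (induction p arbitrary: k k') auto
  then show ?thesis .
qed

lemma ren_quantifiers [simp]:
  "ren r (All s p) = All s (ren r p)" "ren r (Ex s p) = Ex s (ren r p)"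
  by (simp_all add: ren_def map_tms_depth_irrelevant[where k = "Suc 0"])

lemma ren_inst: "ren r (inst s x p) = inst s (r s x) (ren r p)"
  unfolding ren_def inst_def map_tms_map_tms
  by (rule arg_cong[where f = "\<lambda>f. map_tms f 0 p"]) (auto split: tm.splits intro!: ext)

lemma ren_cong: "(\<And>s x. (s, x) \<in> names p \<Longrightarrow> r s x = r' s x) \<Longrightarrow> ren r p = ren r' p"
  unfolding ren_def by (rule map_tms_cong) auto

lemma ren_id: "ren (\<lambda>_ x. x) p = p"
proof -
  have "map_tms (\<lambda>_ s t. case t of Fr x \<Rightarrow> Fr x | Bd n \<Rightarrow> Bd n) k p = p" for k
    by (induction p arbitrary: k) (auto split: tm.splits)
  then show ?thesis by (simp add: ren_def)
qed

lemma finite_names [simp]: "finite (names p)"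
proof -
  have "finite (names_tm s t)" for s t by (cases t) auto
  then show ?thesis by (induction p) auto
qed

lemma fresh_name:
  assumes "finite N"
  obtains x :: string where "(s :: sort, x) \<notin> N"
proof -
  have "finite {x. (s, x) \<in> N}"
    using finite_vimageI[OF assms, of "Pair s"] by (simp add: vimage_def inj_def)
  then obtain x where "x \<notin> {x. (s, x) \<in> N}"
    using ex_new_if_finite infinite_UNIV_listI by blast
  then show thesis using that by blast
qed

text \<open>Finiteness of \<open>G'\<close> guarantees fresh names to which the eigenvariables of the derivation are
  moved; renaming and weakening have to be proved together for that reason.\<close>

lemma deriv_ren:
  assumes "G \<turnstile> p" "finite G'" "ren r ` G \<subseteq> G'"
  shows "G' \<turnstile> ren r p"
  using assms
proof (induction arbitrary: r G' rule: deriv.induct)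
  case (Asm p G)
  then show ?case by (auto intro: deriv.Asm)
next
  case (DisjE G p q t)
  show ?case
    by (rule deriv.DisjE[of _ "ren r p" "ren r q"]) (use DisjE in \<open>simp_all add: subset_insertI2\<close>)
next
  case (ExI G s x p)
  then show ?case by (auto simp: ren_inst intro: deriv.ExI)
next
  case (AllE G s p x)
  then show ?case by (auto simp: ren_inst intro: deriv.AllE)
next
  case (AllI G s x p)
  obtain y where y: "(s, y) \<notin> \<Union> (names ` G') \<union> names (ren r p)"
    using fresh_name[of "\<Union> (names ` G') \<union> names (ren r p)" s] AllI.prems by auto
  \<comment> \<open>The eigenvariable \<open>x\<close> is sent to the fresh \<open>y\<close>. It
    occurs neither in \<open>p\<close> nor in \<open>G\<close>, so \<open>r'\<close> acts on them as
    \<open>r\<close> does.\<close>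
  define r' where "r' = r(s := (r s)(x := y))"
  have "ren r' p = ren r p" "ren r' ` G = ren r ` G"
    using AllI.hyps by (auto simp: r'_def intro!: ren_cong image_cong)
  moreover have "r' s x = y"
    by (simp add: r'_def)
  ultimately have "G' \<turnstile> inst s y (ren r p)"
    using AllI.IH[of G' r'] AllI.prems by (simp add: ren_inst)
  then show ?case using y by (auto intro: deriv.AllI)
next
  case (ExE G s p x q)
  obtain y where y: "(s, y) \<notin> \<Union> (names ` G') \<union> names (ren r p) \<union> names (ren r q)"
    using fresh_name[of "\<Union> (names ` G') \<union> names (ren r p) \<union> names (ren r q)" s] ExE.prems by auto
  define r' where "r' = r(s := (r s)(x := y))"
  have *: "ren r' p = ren r p" "ren r' q = ren r q" "ren r' ` G = ren r ` G"
    using ExE.hyps by (auto simp: r'_def intro!: ren_cong image_cong)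
  moreover have "r' s x = y"
    by (simp add: r'_def)
  ultimately have "insert (inst s y (ren r p)) G' \<turnstile> ren r q"
    using ExE.IH(2)[of "insert (inst s y (ren r p)) G'" r'] ExE.prems by (auto simp: ren_inst)
  then show ?case using deriv.ExE[of G' s "ren r p" y] ExE.IH(1) ExE.prems y by auto
next
  case (EqI G s t)
  then show ?case using ren_Eq_refl deriv.EqI by metis
next
  case (EqE G s x y p)
  then show ?case using deriv.EqE[of G' s "r s x" "r s y" "ren r p"] by (simp add: ren_inst)
next
  case (ImpI p G q)
  show ?case
    using ImpI.IH[of "insert (ren r p) G'" r] ImpI.prems by (auto intro: deriv.ImpI)
next
  case (ImpE G p q)
  show ?case
    by (rule deriv.ImpE[of _ "ren r p"]) (use ImpE in auto)
next
  case (FalsumE G p)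
  show ?case
    by (rule deriv.FalsumE) (use FalsumE in auto)
next
  case (ConjE1 G p q)
  show ?case
    by (rule deriv.ConjE1[of _ _ "ren r q"]) (use ConjE1 in auto)
next
  case (ConjE2 G p q)
  show ?case
    by (rule deriv.ConjE2[of _ "ren r p"]) (use ConjE2 in auto)
qed (simp_all add: deriv.ConjI deriv.DisjI1 deriv.DisjI2)

lemma weaken: "G \<turnstile> p \<Longrightarrow> G \<subseteq> G' \<Longrightarrow> finite G' \<Longrightarrow> G' \<turnstile> p"
  using deriv_ren[of G p G' "\<lambda>_ x. x"] by (simp add: ren_id)

section \<open>Complete theories with witnesses\<close>

text \<open>Closure refers to finite \<open>F\<close> because weakening is available for finite
  contexts: \<open>T\<close> mentions every name and leaves no fresh eigenvariables.\<close>

locale henkin_theory =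
  fixes T :: "fm set"
  assumes Falsum_notin: "Falsum \<notin> T"
    and deriv_closed: "\<lbrakk>F \<turnstile> p; finite F; F \<subseteq> T\<rbrakk> \<Longrightarrow> p \<in> T"
    and complete: "p \<in> T \<or> Imp p Falsum \<in> T"
    and witness: "Ex s p \<in> T \<Longrightarrow> \<exists>x. inst s x p \<in> T"

text \<open>If \<open>p\<close> contradicts \<open>S\<close>, its negation can be added
  consistently. Otherwise \<open>p\<close> is added, with an instance at a fresh name if
  \<open>p\<close> is existential; by \<open>ExE\<close> that instance brings no
  contradiction.\<close>

lemma henkin_step:
  assumes "finite S" "\<not> (S \<turnstile> Falsum)"
  obtains S' where "finite S'" "\<not> (S' \<turnstile> Falsum)" "S \<subseteq> S'" "p \<in> S' \<or> Imp p Falsum \<in> S'"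
    "\<And>s q. p = Ex s q \<Longrightarrow> Ex s q \<in> S' \<Longrightarrow> \<exists>x. inst s x q \<in> S'"
proof (cases "insert p S \<turnstile> Falsum")
  case True
  then have neg: "S \<turnstile> Imp p Falsum" by (rule ImpI)
  have "\<not> (insert (Imp p Falsum) S \<turnstile> Falsum)"
  proof
    assume "insert (Imp p Falsum) S \<turnstile> Falsum"
    from ImpE[OF ImpI[OF this] neg] show False using assms by simp
  qed
  moreover have "p \<notin> S"
  proof
    assume "p \<in> S"
    from ImpE[OF neg Asm[OF this]] show False using assms by simp
  qed
  \<comment> \<open>With \<open>p\<close> absent from \<open>S\<close> and different from its own
    negation, the witness condition is vacuous.\<close>
  moreover have "p = Ex s q \<Longrightarrow> p \<noteq> Imp p Falsum" for s q
    by simp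
  ultimately show thesis
    using assms by (intro that[of "insert (Imp p Falsum) S"]) auto
next
  case False
  show thesis
  proof (cases "\<exists>s q. p = Ex s q")
    case True
    then obtain s q where p: "p = Ex s q" by blast
    obtain x where x: "(s, x) \<notin> \<Union> (names ` insert p S) \<union> names q \<union> names Falsum"
      using fresh_name[of "\<Union> (names ` insert p S) \<union> names q \<union> names Falsum" s] assms by auto
    have ex: "insert p S \<turnstile> Ex s q" using p by (simp add: Asm)
    have "\<not> (insert (inst s x q) (insert p S) \<turnstile> Falsum)"
      using ExE[OF ex _ x] False by iprover
    then show thesis
      using assms p by (intro that[of "insert (inst s x q) (insert p S)"]) auto
  next
    case ex: False
    then show thesis
      using assms False by (intro that[of "insert p S"]) auto
  qed
qed

text \<open>Stage \<open>n\<close> treats the formula numbered \<open>n\<close>; \<open>P\<close> is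
  the invariant of a stage and \<open>Q\<close> relates consecutive stages. Each finite subset of
  the union lies in one stage, so consistency passes to the union.\<close>

lemma henkin_extension:
  assumes "finite F" "\<not> (F \<turnstile> Falsum)"
  obtains T where "henkin_theory T" "F \<subseteq> T"
proof -
  define P where "P = (\<lambda>(_ :: nat) S. finite S \<and> \<not> (S \<turnstile> Falsum) \<and> F \<subseteq> S)"
  define Q where "Q = (\<lambda>n S S'. S \<subseteq> S' \<and>
    (from_nat n \<in> S' \<or> Imp (from_nat n) Falsum \<in> S') \<and>
    (\<forall>s q. from_nat n = Ex s q \<longrightarrow> Ex s q \<in> S' \<longrightarrow> (\<exists>x. inst s x q \<in> S')))"
  have "P 0 F"
    using assms by (simp add: P_def)
  moreover have "\<exists>S'. P (Suc n) S' \<and> Q n S S'" if P: "P n S" for n S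
  proof -
    have S: "finite S" "\<not> (S \<turnstile> Falsum)" "F \<subseteq> S"
      using P by (simp_all add: P_def)
    obtain S' where S': "finite S'" "\<not> (S' \<turnstile> Falsum)" "S \<subseteq> S'"
        "from_nat n \<in> S' \<or> Imp (from_nat n) Falsum \<in> S'"
        "\<And>s q. from_nat n = Ex s q \<Longrightarrow> Ex s q \<in> S' \<Longrightarrow> \<exists>x. inst s x q \<in> S'"
      by (rule henkin_step[OF S(1,2), of "from_nat n"]) iprover
    have "P (Suc n) S'"
      unfolding P_def using S' S(3) by simp
    moreover have "Q n S S'"
      unfolding Q_def using S'(3-5) by simp
    ultimately show ?thesis by iprover
  qed
  ultimately obtain S where S: "\<And>n. P n (S n)" "\<And>n. Q n (S n) (S (Suc n))"
    using dependent_nat_choice[of P Q] by metis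
  define T where "T = (\<Union>n. S n)"
  have in_T: "p \<in> T" if "p \<in> S n" for p n
    using that by (auto simp: T_def)
  have mono: "S m \<subseteq> S n" if "m \<le> n" for m n
  proof (rule lift_Suc_mono_le[OF _ that])
    show "S n \<subseteq> S (Suc n)" for n
      using S(2)[of n] unfolding Q_def by (elim conjE)
  qed
  have fin: "\<exists>n. E \<subseteq> S n" if "finite E" "E \<subseteq> T" for E
    using that
  proof (induction E)
    case (insert p E)
    then obtain m n where "E \<subseteq> S m" "p \<in> S n" by (auto simp: T_def)
    then have "insert p E \<subseteq> S (max m n)"
      using mono[of m "max m n"] mono[of n "max m n"] by auto
    then show ?case ..
  qed simp
  have complete: "p \<in> T \<or> Imp p Falsum \<in> T" for p
  proof -
    have "p \<in> S (Suc (to_nat p)) \<or> Imp p Falsum \<in> S (Suc (to_nat p))"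
      using S(2)[of "to_nat p"] unfolding Q_def from_nat_to_nat by (elim conjE)
    then show ?thesis using in_T by blast
  qed
  have consistent: "\<not> (E \<turnstile> Falsum)" if E: "finite E" "E \<subseteq> T" for E
  proof
    assume "E \<turnstile> Falsum"
    moreover obtain n where "E \<subseteq> S n" using fin[OF E] ..
    moreover have "finite (S n)" using S(1)[of n] by (simp add: P_def)
    ultimately have "S n \<turnstile> Falsum" by (rule weaken)
    then show False using S(1)[of n] by (simp add: P_def)
  qed
  have contra: False if "p \<in> T" "Imp p Falsum \<in> T" for p
  proof -
    have "{p, Imp p Falsum} \<turnstile> Falsum"
      by (rule ImpE[of _ p]; rule Asm; simp)
    then show False using consistent[of "{p, Imp p Falsum}"] that by simp
  qed
  have "henkin_theory T"
  proof
    show "Falsum \<notin> T"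
      using consistent[of "{Falsum}"] Asm[of Falsum "{Falsum}"] by auto
    show "p \<in> T" if "E \<turnstile> p" "finite E" "E \<subseteq> T" for E p
    proof (rule ccontr)
      assume "p \<notin> T"
      then have "Imp p Falsum \<in> T" using complete by blast
      moreover have "insert (Imp p Falsum) E \<turnstile> Falsum"
        by (rule ImpE[OF Asm weaken[OF that(1)]]) (use that in auto)
      ultimately show False using consistent[of "insert (Imp p Falsum) E"] that by simp
    qed
    show "\<exists>x. inst s x p \<in> T" if ex: "Ex s p \<in> T" for s p
    proof -
      \<comment> \<open>The existential formula was decided at its own stage. Its negation would
        contradict \<open>ex\<close>, so the formula itself is in that stage, together with a
        witness.\<close>
      let ?S = "S (Suc (to_nat (Ex s p)))"
      note step = S(2)[of "to_nat (Ex s p)", unfolded Q_def from_nat_to_nat]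
      have Q: "Ex s p \<in> ?S \<or> Imp (Ex s p) Falsum \<in> ?S"
        using step by (elim conjE)
      have w: "\<forall>s' q. Ex s p = Ex s' q \<longrightarrow> Ex s' q \<in> ?S \<longrightarrow> (\<exists>x. inst s' x q \<in> ?S)"
        using step by (elim conjE)
      have "Imp (Ex s p) Falsum \<notin> ?S"
        using contra[OF ex] in_T[of "Imp (Ex s p) Falsum"] by iprover
      with Q have "Ex s p \<in> ?S" by simp
      with w obtain x where "inst s x p \<in> ?S" by auto
      then show ?thesis
        using in_T by blast
    qed
  qed (rule complete)
  moreover have "F \<subseteq> T"
    using S(1)[of 0] in_T unfolding P_def by blast
  ultimately show thesis by (rule that)
qed

section \<open>Membership in a complete theory as classical truth\<close>

context henkin_theory
begin

lemma Falsum_in [simp]: "Falsum \<in> T \<longleftrightarrow> False"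
  using Falsum_notin by blast

text \<open>If \<open>p\<close> is missing from \<open>T\<close>, completeness supplies its
  negation, and ex falso yields the implication.\<close>

lemma Imp_in [simp]: "Imp p q \<in> T \<longleftrightarrow> (p \<in> T \<longrightarrow> q \<in> T)"
proof
  assume pq: "Imp p q \<in> T"
  have "{Imp p q, p} \<turnstile> q"
    by (rule ImpE[of _ p]; rule Asm; simp)
  then show "p \<in> T \<longrightarrow> q \<in> T"
    using deriv_closed[of "{Imp p q, p}" q] pq by simp
next
  assume pq: "p \<in> T \<longrightarrow> q \<in> T"
  show "Imp p q \<in> T"
  proof (cases "q \<in> T")
    case True
    have "{q} \<turnstile> Imp p q"
      by (rule ImpI, rule Asm) simp
    then show ?thesis
      using deriv_closed[of "{q}" "Imp p q"] True by simp
  next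
    case False
    then have "Imp p Falsum \<in> T" using complete pq by blast
    moreover have "{Imp p Falsum} \<turnstile> Imp p q"
      by (rule ImpI, rule FalsumE, rule ImpE[of _ p]; rule Asm; simp)
    ultimately show ?thesis
      using deriv_closed[of "{Imp p Falsum}" "Imp p q"] by simp
  qed
qed

lemma Conj_in [simp]: "Conj p q \<in> T \<longleftrightarrow> p \<in> T \<and> q \<in> T"
proof
  assume pq: "Conj p q \<in> T"
  have "{Conj p q} \<turnstile> p"
    by (rule ConjE1[of _ p q], rule Asm) simp
  moreover have "{Conj p q} \<turnstile> q"
    by (rule ConjE2[of _ p q], rule Asm) simp
  ultimately show "p \<in> T \<and> q \<in> T"
    using deriv_closed[of "{Conj p q}" p] deriv_closed[of "{Conj p q}" q] pq by simp
next
  assume "p \<in> T \<and> q \<in> T"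
  moreover have "{p, q} \<turnstile> Conj p q"
    by (rule ConjI; rule Asm; simp)
  ultimately show "Conj p q \<in> T"
    using deriv_closed[of "{p, q}" "Conj p q"] by simp
qed

text \<open>\<open>T\<close> is prime: otherwise both negations lie in \<open>T\<close> and derive
  \<open>Falsum\<close> from the disjunction.\<close>

lemma Disj_in [simp]: "Disj p q \<in> T \<longleftrightarrow> p \<in> T \<or> q \<in> T"
proof -
  have "{p} \<turnstile> Disj p q" "{q} \<turnstile> Disj p q"
    by (auto intro: DisjI1 DisjI2 Asm)
  moreover have "{Disj p q, Imp p Falsum, Imp q Falsum} \<turnstile> Falsum"
  proof (rule DisjE[of _ p q])
    show "insert p {Disj p q, Imp p Falsum, Imp q Falsum} \<turnstile> Falsum"
      by (rule ImpE[of _ p]; rule Asm; simp)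
    show "insert q {Disj p q, Imp p Falsum, Imp q Falsum} \<turnstile> Falsum"
      by (rule ImpE[of _ q]; rule Asm; simp)
  qed (rule Asm, simp)
  ultimately show ?thesis
    using deriv_closed[of "{p}" "Disj p q"] deriv_closed[of "{q}" "Disj p q"]
      deriv_closed[of "{Disj p q, Imp p Falsum, Imp q Falsum}" Falsum] by auto
qed

lemma Ex_in [simp]: "Ex s p \<in> T \<longleftrightarrow> (\<exists>x. inst s x p \<in> T)"
proof
  assume "\<exists>x. inst s x p \<in> T"
  then obtain x where "inst s x p \<in> T" ..
  then show "Ex s p \<in> T"
    using deriv_closed[OF ExI[OF Asm], of s x p "{inst s x p}"] by simp
qed (rule witness)

lemma All_inD: "All s p \<in> T \<Longrightarrow> inst s x p \<in> T"
  using deriv_closed[OF AllE[OF Asm], of s p "{All s p}"] by simp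

lemma Eq_refl: "Eq s t t \<in> T"
  using deriv_closed[OF EqI, of "{}"] by simp

lemma Eq_subst:
  assumes "Eq s (Fr x) (Fr y) \<in> T" "inst s x p \<in> T"
  shows "inst s y p \<in> T"
  using deriv_closed[OF EqE[OF Asm Asm], of s x y "{Eq s (Fr x) (Fr y), inst s x p}" p] assms by auto

lemma Eq_sym: "Eq s (Fr x) (Fr y) \<in> T \<Longrightarrow> Eq s (Fr y) (Fr x) \<in> T"
  using Eq_subst[of s x y "Eq s (Bd 0) (Fr x)"] Eq_refl by (simp add: inst_def)

lemma Eq_trans: "Eq s (Fr x) (Fr y) \<in> T \<Longrightarrow> Eq s (Fr y) (Fr z) \<in> T \<Longrightarrow> Eq s (Fr x) (Fr z) \<in> T"
  using Eq_subst[of s y z "Eq s (Fr x) (Bd 0)"] by (simp add: inst_def)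

section \<open>Names modulo provable equality\<close>

definition cls :: "sort \<Rightarrow> string \<Rightarrow> string set" where
  "cls s x = {y. Eq s (Fr x) (Fr y) \<in> T}"

lemma cls_eq_iff: "cls s x = cls s y \<longleftrightarrow> Eq s (Fr x) (Fr y) \<in> T"
proof
  assume "cls s x = cls s y"
  moreover have "y \<in> cls s y"
    by (simp add: cls_def Eq_refl)
  ultimately show "Eq s (Fr x) (Fr y) \<in> T"
    unfolding cls_def by blast
next
  assume "Eq s (Fr x) (Fr y) \<in> T"
  then show "cls s x = cls s y"
    unfolding cls_def by (auto intro: Eq_trans dest: Eq_sym)
qed

definition incident :: "string set \<Rightarrow> string set \<Rightarrow> bool" where
  "incident P l \<longleftrightarrow> (\<exists>x y. P = cls Pt x \<and> l = cls Ln y \<and> Inc (Fr x) (Fr y) \<in> T)"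

text \<open>Substituting provably equal names, one position at a time, shows independence of the
  representatives.\<close>

lemma incident_cls [simp]: "incident (cls Pt x) (cls Ln y) \<longleftrightarrow> Inc (Fr x) (Fr y) \<in> T"
proof
  assume "incident (cls Pt x) (cls Ln y)"
  then obtain x' y' where *: "Eq Pt (Fr x') (Fr x) \<in> T" "Eq Ln (Fr y') (Fr y) \<in> T"
      "Inc (Fr x') (Fr y') \<in> T"
    unfolding incident_def cls_eq_iff by (auto dest: Eq_sym)
  have "Inc (Fr x) (Fr y') \<in> T"
    using Eq_subst[OF *(1), of "Inc (Bd 0) (Fr y')"] *(3) by (simp add: inst_def)
  then show "Inc (Fr x) (Fr y) \<in> T"
    using Eq_subst[OF *(2), of "Inc (Fr x) (Bd 0)"] by (simp add: inst_def)
qed (auto simp: incident_def)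

lemma Neq_Eq_contra:
  assumes "Eq s (Fr x) (Fr y) \<in> T" "Neq s (Fr x) (Fr y) \<in> T"
  shows "Neq s (Fr y) (Fr y) \<in> T"
  using Eq_subst[of s x y "Neq s (Bd 0) (Fr y)"] assms by (simp add: inst_def)

end

section \<open>Closed formulas\<close>

primrec lc_tm :: "nat \<Rightarrow> tm \<Rightarrow> bool" where
  "lc_tm k (Fr x) = True"
| "lc_tm k (Bd n) = (n < k)"

primrec lc :: "nat \<Rightarrow> fm \<Rightarrow> bool" where
  "lc k Falsum = True"
| "lc k (Eq s t u) = (lc_tm k t \<and> lc_tm k u)"
| "lc k (Neq s t u) = (lc_tm k t \<and> lc_tm k u)"
| "lc k (Inc t u) = (lc_tm k t \<and> lc_tm k u)"
| "lc k (Conj p q) = (lc k p \<and> lc k q)"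
| "lc k (Disj p q) = (lc k p \<and> lc k q)"
| "lc k (Imp p q) = (lc k p \<and> lc k q)"
| "lc k (All s p) = lc (Suc k) p"
| "lc k (Ex s p) = lc (Suc k) p"

text \<open>A dangling index could be captured: at the depth of the new quantifier it would become
  \<open>x\<close>. Local closure rules this out.\<close>

lemma inst_bind_name:
  assumes "lc 0 p"
  shows "inst s x (bind_name s x p) = p"
proof -
  define f where "f = (\<lambda>k s' t. if s' = s \<and> t = Bd k then Fr x else t)"
  define g where "g = (\<lambda>k s' t. if s' = s \<and> t = Fr x then Bd k else t)"
  have tm: "lc_tm k t \<Longrightarrow> f k s' (g k s' t) = t" for k s' t
    by (cases t) (auto simp: f_def g_def)
  have "map_tms f k (map_tms g k p) = p" if "lc k p" for k
    using that by (induction p arbitrary: k) (simp_all add: tm)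
  then show ?thesis
    using assms by (simp add: inst_def bind_name_def f_def g_def)
qed

lemma lc_All_bind_name:
  assumes "lc 0 p"
  shows "lc 0 (All s (bind_name s x p))"
proof -
  define g where "g = (\<lambda>k s' t. if s' = s \<and> t = Fr x then Bd k else t)"
  have tm: "lc_tm k t \<Longrightarrow> lc_tm (Suc k) (g k s' t)" for k s' t
    by (cases t) (auto simp: g_def)
  have "lc (Suc k) (map_tms g k p)" if "lc k p" for k
    using that by (induction p arbitrary: k) (simp_all add: tm)
  then show ?thesis
    using assms by (simp add: bind_name_def g_def)
qed

lemma names_bind_name: "names (bind_name s x p) = names p - {(s, x)}"
proof -
  define g where "g = (\<lambda>k s' t. if s' = s \<and> t = Fr x then Bd k else t)"
  have tm: "names_tm s' (g k s' t) = names_tm s' t - {(s, x)}" for s' t k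
    by (cases t) (auto simp: g_def)
  have "names (map_tms g k p) = names p - {(s, x)}" for k
    by (induction p arbitrary: k) (simp_all add: tm Un_Diff)
  then show ?thesis
    by (simp add: bind_name_def g_def)
qed

lemma names_all_names: "names (all_names s xs p) = names p - Pair s ` set xs"
  by (induction xs) (auto simp: all_names_def names_bind_name)

lemma names_ex_names: "names (ex_names s xs p) = names p - Pair s ` set xs"
  by (induction xs) (auto simp: ex_names_def names_bind_name)

lemma lc_all_names: "lc 0 p \<Longrightarrow> lc 0 (all_names s xs p)"
  by (induction xs) (simp_all add: all_names_def lc_All_bind_name del: lc.simps)

text \<open>Each name serves as its own eigenvariable, since instantiating the newly bound body at
  \<open>x\<close> gives the formula back.\<close>

lemma all_namesI:
  assumes "G \<turnstile> p" "lc 0 p" "\<And>x. x \<in> set xs \<Longrightarrow> (s, x) \<notin> \<Union> (names ` G)"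
  shows "G \<turnstile> all_names s xs p"
  using assms(3)
proof (induction xs)
  case Nil
  then show ?case using assms(1) by (simp add: all_names_def)
next
  case (Cons x xs)
  let ?q = "all_names s xs p"
  have "G \<turnstile> inst s x (bind_name s x ?q)"
    using Cons by (simp add: inst_bind_name lc_all_names assms(2))
  then have "G \<turnstile> All s (bind_name s x ?q)"
    by (rule AllI) (use Cons.prems names_bind_name in auto)
  then show ?case by (simp add: all_names_def)
qed

section \<open>The plane of a complete theory\<close>

lemmas syntax_simps = all_names_def ex_names_def bind_name_def outside_def joins_def meets_def
  Defs.triangle_def

locale desarguesian_theory = henkin_theory +
  assumes plane: "Desarguesian_plane \<subseteq> T" 
    and eight: "eight_lines_through_each_point \<in> T"
begin

text \<open>Tightness turns the absence of \<open>Neq\<close> into equality; irreflexivity and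
  substitution exclude having both.\<close>

lemma Neq_in: "Neq s (Fr x) (Fr y) \<in> T \<longleftrightarrow> cls s x \<noteq> cls s y"
proof -
  have A: "inequality_axioms s \<subseteq> T"
    using plane by (cases s) (auto simp: Desarguesian_plane_def)
  then have irr: "Neq s (Fr z) (Fr z) \<notin> T" for z
    using All_inD[of s _ z] by (fastforce simp: inequality_axioms_def all_names_def bind_name_def inst_def)
  have "(\<^bold>\<forall>[s] [''x'', ''y'']. \<^bold>\<not> (''x'' \<^bold>\<noteq>[s] ''y'') \<^bold>\<longrightarrow> ''x'' \<^bold>=[s] ''y'') \<in> T"
    using A by (simp add: inequality_axioms_def)
  then have 1: "All s (All s (Imp (Imp (Neq s (Bd 1) (Bd 0)) Falsum) (Eq s (Bd 1) (Bd 0)))) \<in> T"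
    by (simp add: all_names_def bind_name_def)
  have "Neq s (Fr x) (Fr y) \<in> T \<or> Eq s (Fr x) (Fr y) \<in> T"
    using All_inD[OF All_inD[OF 1, of x, unfolded inst_def, simplified], of y]
    by (auto simp: inst_def)
  then show ?thesis
    unfolding cls_eq_iff using Neq_Eq_contra irr by blast
qed

text \<open>Instantiating at \<open>P\<close> itself contradicts irreflexivity if \<open>P\<close>
  is on \<open>l\<close>. Conversely, C6 puts the universal formula into \<open>T\<close> without
  appeal to a counterexample. The left side is \<open>outside\<close> unfolded, as it occurs in
  instantiated axioms.\<close>

lemma outside_in:
  "All Pt (Imp (Inc (Bd 0) (Fr l)) (Neq Pt (Fr P) (Bd 0))) \<in> T \<longleftrightarrow> Inc (Fr P) (Fr l) \<notin> T"
proof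
  assume "All Pt (Imp (Inc (Bd 0) (Fr l)) (Neq Pt (Fr P) (Bd 0))) \<in> T"
  from All_inD[OF this, of P] show "Inc (Fr P) (Fr l) \<notin> T"
    by (simp add: inst_def Neq_in)
next
  assume *: "Inc (Fr P) (Fr l) \<notin> T"
  have "C6 \<in> T"
    using plane by (simp add: Desarguesian_plane_def)
  then have 1: "All Pt (All Ln (Imp (Imp (All Pt (Imp (Inc (Bd 0) (Bd 1)) (Neq Pt (Bd 2) (Bd 0)))) Falsum)
      (Inc (Bd 1) (Bd 0)))) \<in> T"
    by (simp add: C6_def all_names_def bind_name_def outside_def numeral_2_eq_2)
  show "All Pt (Imp (Inc (Bd 0) (Fr l)) (Neq Pt (Fr P) (Bd 0))) \<in> T"
    using All_inD[OF All_inD[OF 1, of P, unfolded inst_def, simplified], of l] *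
    by (auto simp: inst_def)
qed

lemma Eq_in: "Eq s (Fr x) (Fr y) \<in> T \<longleftrightarrow> cls s x = cls s y"
  by (simp add: cls_eq_iff)

lemmas in_simps = inst_def outside_in Neq_in Eq_in

lemma C2_in:
  assumes "cls Pt P \<noteq> cls Pt Q"
  shows "\<exists>l. Inc (Fr P) (Fr l) \<in> T \<and> Inc (Fr Q) (Fr l) \<in> T \<and>
    (\<forall>m. Inc (Fr P) (Fr m) \<in> T \<longrightarrow> Inc (Fr Q) (Fr m) \<in> T \<longrightarrow> cls Ln m = cls Ln l)"
proof -
  have "C2 \<in> T"
    using plane by (simp add: Desarguesian_plane_def)
  then have 1: "All Pt (All Pt (Imp (Neq Pt (Bd 1) (Bd 0)) (Ex Ln (Conj (Conj (Inc (Bd 2) (Bd 0)) (Inc (Bd 1) (Bd 0)))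
      (All Ln (Imp (Conj (Inc (Bd 3) (Bd 0)) (Inc (Bd 2) (Bd 0))) (Eq Ln (Bd 0) (Bd 1)))))))) \<in> T"
    by (simp add: C2_def syntax_simps numeral_2_eq_2 numeral_3_eq_3)
  have "Ex Ln (Conj (Conj (Inc (Fr P) (Bd 0)) (Inc (Fr Q) (Bd 0)))
      (All Ln (Imp (Conj (Inc (Fr P) (Bd 0)) (Inc (Fr Q) (Bd 0))) (Eq Ln (Bd 0) (Bd 1))))) \<in> T"
    using All_inD[OF All_inD[OF 1, of P, unfolded inst_def, simplified], of Q] assms
    by (simp add: in_simps)
  then obtain l where "Inc (Fr P) (Fr l) \<in> T" "Inc (Fr Q) (Fr l) \<in> T"
      "All Ln (Imp (Conj (Inc (Fr P) (Bd 0)) (Inc (Fr Q) (Bd 0))) (Eq Ln (Bd 0) (Fr l))) \<in> T"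
    by (auto simp: inst_def)
  moreover have "cls Ln m = cls Ln l" if "Inc (Fr P) (Fr m) \<in> T" "Inc (Fr Q) (Fr m) \<in> T" for m
    using All_inD[OF calculation(3), of m] that by (simp add: in_simps)
  ultimately show ?thesis
    by blast
qed

lemma C3_in:
  assumes "cls Ln l \<noteq> cls Ln m"
  shows "\<exists>P. Inc (Fr P) (Fr l) \<in> T \<and> Inc (Fr P) (Fr m) \<in> T"
proof -
  have "C3 \<in> T"
    using plane by (simp add: Desarguesian_plane_def)
  then have 1: "All Ln (All Ln (Imp (Neq Ln (Bd 1) (Bd 0)) (Ex Pt (Conj (Conj (Inc (Bd 0) (Bd 2)) (Inc (Bd 0) (Bd 1)))
      (All Pt (Imp (Conj (Inc (Bd 0) (Bd 3)) (Inc (Bd 0) (Bd 2))) (Eq Pt (Bd 0) (Bd 1)))))))) \<in> T"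
    by (simp add: C3_def syntax_simps numeral_2_eq_2 numeral_3_eq_3)
  show ?thesis
    using All_inD[OF All_inD[OF 1, of l, unfolded inst_def, simplified], of m] assms
    by (auto simp: in_simps)
qed

text \<open>Phrased by cardinality so that avoiding four given lines becomes counting.\<close>

lemma eight_lines_in: "\<exists>M. card M = 8 \<and> (\<forall>m \<in> M. incident (cls Pt P) m)"
proof -
  note 1 = eight[unfolded eight_lines_through_each_point_def syntax_simps, simplified]
  have "\<exists>l1 l2 l3 l4 l5 l6 l7 l8. distinct (map (cls Ln) [l1, l2, l3, l4, l5, l6, l7, l8]) \<and>
      (\<forall>l \<in> set [l1, l2, l3, l4, l5, l6, l7, l8]. Inc (Fr P) (Fr l) \<in> T)"
    using All_inD[OF 1, of P] by (simp add: in_simps conj_ac)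
  then obtain ls where "length ls = 8" "distinct (map (cls Ln) ls)" "\<forall>l \<in> set ls. Inc (Fr P) (Fr l) \<in> T"
    by (elim exE conjE) (rule that; simp only: list.size; simp)
  moreover from this have "card (set (map (cls Ln) ls)) = 8"
    using distinct_card by fastforce
  ultimately show ?thesis
    by (intro exI[of _ "set (map (cls Ln) ls)"]) auto
qed

lemma Desargues_in:
  assumes t1: "tri incident (cls Pt A) (cls Pt B) (cls Pt C) (cls Ln a) (cls Ln b) (cls Ln c)"
    and t2: "tri incident (cls Pt A') (cls Pt B') (cls Pt C') (cls Ln a') (cls Ln b') (cls Ln c')"
    and "cls Pt A \<noteq> cls Pt A'" "cls Pt B \<noteq> cls Pt B'" "cls Pt C \<noteq> cls Pt C'"
      "cls Ln a \<noteq> cls Ln a'" "cls Ln b \<noteq> cls Ln b'" "cls Ln c \<noteq> cls Ln c'"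
      "Inc (Fr A) (Fr u) \<in> T" "Inc (Fr A') (Fr u) \<in> T" "Inc (Fr B) (Fr v) \<in> T"
      "Inc (Fr B') (Fr v) \<in> T" "Inc (Fr C) (Fr w) \<in> T" "Inc (Fr C') (Fr w) \<in> T"
      "Inc (Fr V) (Fr u) \<in> T" "Inc (Fr V) (Fr v) \<in> T" "Inc (Fr V) (Fr w) \<in> T"
      "Inc (Fr V) (Fr a) \<notin> T" "Inc (Fr V) (Fr b) \<notin> T" "Inc (Fr V) (Fr c) \<notin> T"
      "Inc (Fr V) (Fr a') \<notin> T" "Inc (Fr V) (Fr b') \<notin> T" "Inc (Fr V) (Fr c') \<notin> T"
  shows "\<exists>k X Y Z. Inc (Fr X) (Fr a) \<in> T \<and> Inc (Fr X) (Fr a') \<in> T \<and>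
    Inc (Fr Y) (Fr b) \<in> T \<and> Inc (Fr Y) (Fr b') \<in> T \<and>
    Inc (Fr Z) (Fr c) \<in> T \<and> Inc (Fr Z) (Fr c') \<in> T \<and>
    Inc (Fr X) (Fr k) \<in> T \<and> Inc (Fr Y) (Fr k) \<in> T \<and> Inc (Fr Z) (Fr k) \<in> T"
proof -
  have 0: "Desargues \<in> T"
    using plane by (simp add: Desarguesian_plane_def)
  note 1 = 0[unfolded Desargues_def syntax_simps, simplified]
  \<comment> \<open>The sixteen quantifiers are removed one by one. The last instance is left to
    \<open>in_simps\<close>, which also rewrites \<open>Neq\<close> and outside into classical
    negations.\<close>
  note 2 = All_inD[OF 1, of A, unfolded inst_def, simplified]
  note 3 = All_inD[OF 2, of B, unfolded inst_def, simplified]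
  note 4 = All_inD[OF 3, of C, unfolded inst_def, simplified]
  note 5 = All_inD[OF 4, of A', unfolded inst_def, simplified]
  note 6 = All_inD[OF 5, of B', unfolded inst_def, simplified]
  note 7 = All_inD[OF 6, of C', unfolded inst_def, simplified]
  note 8 = All_inD[OF 7, of V, unfolded inst_def, simplified]
  note 9 = All_inD[OF 8, of a, unfolded inst_def, simplified]
  note 10 = All_inD[OF 9, of b, unfolded inst_def, simplified]
  note 11 = All_inD[OF 10, of c, unfolded inst_def, simplified]
  note 12 = All_inD[OF 11, of a', unfolded inst_def, simplified]
  note 13 = All_inD[OF 12, of b', unfolded inst_def, simplified]
  note 14 = All_inD[OF 13, of c', unfolded inst_def, simplified]
  note 15 = All_inD[OF 14, of u, unfolded inst_def, simplified]
  note 16 = All_inD[OF 15, of v, unfolded inst_def, simplified]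
  note 17 = All_inD[OF 16, of w]
  have "\<exists>k X Y Z. (Inc (Fr X) (Fr a) \<in> T \<and> Inc (Fr X) (Fr a') \<in> T) \<and>
      (Inc (Fr Y) (Fr b) \<in> T \<and> Inc (Fr Y) (Fr b') \<in> T) \<and>
      (Inc (Fr Z) (Fr c) \<in> T \<and> Inc (Fr Z) (Fr c') \<in> T) \<and>
      Inc (Fr X) (Fr k) \<in> T \<and> Inc (Fr Y) (Fr k) \<in> T \<and> Inc (Fr Z) (Fr k) \<in> T \<and>
      Inc (Fr A) (Fr k) \<notin> T \<and> Inc (Fr B) (Fr k) \<notin> T \<and> Inc (Fr C) (Fr k) \<notin> T \<and>
      Inc (Fr A') (Fr k) \<notin> T \<and> Inc (Fr B') (Fr k) \<notin> T \<and> Inc (Fr C') (Fr k) \<notin> T"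
    using 17 assms unfolding tri_def by (simp add: in_simps)
  then show ?thesis
    by blast
qed

lemma cls_of_incident:
  assumes "incident P l"
  obtains x y where "P = cls Pt x" "l = cls Ln y"
  using assms by (auto simp: incident_def)

sublocale desarguesian incident
proof
  fix P Q l m
  assume "incident P l" "incident Q l" "incident P m" "incident Q m"
  moreover from this obtain P' Q' l' m' where "P = cls Pt P'" "Q = cls Pt Q'" "l = cls Ln l'" "m = cls Ln m'"
    by (metis cls_of_incident)
  ultimately show "P = Q \<or> l = m"
    using C2_in[of P' Q'] by auto
next
  fix P Q l m
  assume *: "incident P l" "incident Q m"
  then obtain P' Q' l' m' where e: "P = cls Pt P'" "Q = cls Pt Q'" "l = cls Ln l'" "m = cls Ln m'"
    by (metis cls_of_incident)
  \<comment> \<open>For \<open>P = Q\<close> the line \<open>l\<close> of the premise serves; below,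
    for \<open>l = m\<close>, the point \<open>P\<close> does.\<close>
  show "\<exists>k. incident P k \<and> incident Q k"
  proof (cases "P = Q")
    case False
    then obtain k where "Inc (Fr P') (Fr k) \<in> T" "Inc (Fr Q') (Fr k) \<in> T"
      using C2_in e by blast
    then show ?thesis using e by (intro exI[of _ "cls Ln k"]) simp
  qed (use * in blast)
  show "\<exists>X. incident X l \<and> incident X m"
  proof (cases "l = m")
    case False
    then obtain X where "Inc (Fr X) (Fr l') \<in> T" "Inc (Fr X) (Fr m') \<in> T"
      using C3_in e by blast
    then show ?thesis using e by (intro exI[of _ "cls Pt X"]) simp
  qed (use * in blast)
next
  fix P l l1 l2 l3 l4
  assume "incident P l"
  then obtain M where M: "card M = 8" "\<forall>m \<in> M. incident P m"
    using eight_lines_in by (metis cls_of_incident)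
  have "\<not> M \<subseteq> {l1, l2, l3, l4}"
  proof
    assume "M \<subseteq> {l1, l2, l3, l4}"
    then have "card M \<le> card {l1, l2, l3, l4}" by (intro card_mono) auto
    also have "\<dots> \<le> 4" by (simp add: card_insert_if)
    finally show False using M by simp
  qed
  then show "\<exists>m. incident P m \<and> m \<notin> {l1, l2, l3, l4}" using M by blast
next
  fix A B C A' B' C' V a b c a' b' c' u v w
  assume t: "tri incident A B C a b c" "tri incident A' B' C' a' b' c'"
    and ne: "A \<noteq> A'" "B \<noteq> B'" "C \<noteq> C'" "a \<noteq> a'" "b \<noteq> b'" "c \<noteq> c'"
    and i: "incident A u" "incident A' u" "incident B v" "incident B' v" "incident C w" "incident C' w"
      "incident V u" "incident V v" "incident V w"
    and o: "\<not> incident V a" "\<not> incident V b" "\<not> incident V c"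
      "\<not> incident V a'" "\<not> incident V b'" "\<not> incident V c'"
  \<comment> \<open>Every vertex and every side occurs once in these incidences, so all twelve are
    classes of names.\<close>
  have "incident B a" "incident C b" "incident A c" "incident B' a'" "incident C' b'" "incident A' c'"
    using t by (simp_all add: tri_def)
  then obtain An Bn Cn Am Bm Cm an bn cn am bm cm where
    e: "A = cls Pt An" "B = cls Pt Bn" "C = cls Pt Cn"
      "A' = cls Pt Am" "B' = cls Pt Bm" "C' = cls Pt Cm"
      "a = cls Ln an" "b = cls Ln bn" "c = cls Ln cn"
      "a' = cls Ln am" "b' = cls Ln bm" "c' = cls Ln cm"
    unfolding incident_def by blast
  obtain Vn un vn wn where e': "V = cls Pt Vn" "u = cls Ln un" "v = cls Ln vn" "w = cls Ln wn"
    using i unfolding incident_def by blast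
  obtain k X Y Z where
    "Inc (Fr X) (Fr an) \<in> T" "Inc (Fr X) (Fr am) \<in> T" "Inc (Fr Y) (Fr bn) \<in> T"
    "Inc (Fr Y) (Fr bm) \<in> T" "Inc (Fr Z) (Fr cn) \<in> T" "Inc (Fr Z) (Fr cm) \<in> T"
    "Inc (Fr X) (Fr k) \<in> T" "Inc (Fr Y) (Fr k) \<in> T" "Inc (Fr Z) (Fr k) \<in> T"
    using Desargues_in[OF t[unfolded e] ne[unfolded e] i[unfolded e e' incident_cls]
      o[unfolded e e' incident_cls]] by blast
  then show "\<exists>k X Y Z. incident X a \<and> incident X a' \<and> incident Y b \<and> incident Y b' \<and>
      incident Z c \<and> incident Z c' \<and> incident X k \<and> incident Y k \<and> incident Z k"
    by (intro exI[of _ "cls Ln k"] exI[of _ "cls Pt X"] exI[of _ "cls Pt Y"] exI[of _ "cls Pt Z"])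
      (simp add: e)
qed

end

section \<open>Derivation of the invariance theorem\<close>

theorem theorem3p2:
  shows "Desarguesian_plane \<union> {eight_lines_through_each_point} \<turnstile>
    (\<^bold>\<forall>[Pt] [''A'', ''B'', ''C'', ''R'', ''P'', ''Q'', ''S'', ''D'',
            ''R1'', ''P1'', ''Q1'', ''S1'', ''D1''].
     \<^bold>\<forall>[Ln] [''ab'', ''l'', ''br'', ''ar'', ''ap'', ''bq'', ''rs'',
            ''l1'', ''br1'', ''ar1'', ''ap1'', ''bq1'', ''rs1''].
      conjs
       [''A'' \<^bold>\<noteq>[Pt] ''B'', joins ''ab'' ''A'' ''B'', ''C'' \<^bold>\<in> ''ab'',
        auxiliary ''ab'' ''C'' ''l'' ''R'',
        auxiliary ''ab'' ''C'' ''l1'' ''R1'',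
        harmonic_construction ''A'' ''B'' ''ab'' ''l'' ''R''
          ''br'' ''ar'' ''P'' ''Q'' ''ap'' ''bq'' ''S'' ''rs'' ''D'',
        harmonic_construction ''A'' ''B'' ''ab'' ''l1'' ''R1''
          ''br1'' ''ar1'' ''P1'' ''Q1'' ''ap1'' ''bq1'' ''S1'' ''rs1'' ''D1'']
      \<^bold>\<longrightarrow> ''D'' \<^bold>=[Pt] ''D1'')" (is "?G \<turnstile> all_names _ _ (all_names _ _ (?hyps \<^bold>\<longrightarrow> _))")
proof -
  let ?H = "insert ?hyps ?G"
  let ?neq = "''D'' \<^bold>\<noteq>[Pt] ''D1''"
  have "insert ?neq ?H \<turnstile> Falsum"
  \<comment> \<open>The case distinction is made in the metalogic, about derivability: a consistent
    context would yield a classical plane in which \<open>D\<close> and \<open>D1\<close>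
    differ.\<close>
  proof (rule ccontr)
    assume "\<not> (insert ?neq ?H \<turnstile> Falsum)"
    moreover have "finite (insert ?neq ?H)"
      by (simp add: Desarguesian_plane_def inequality_axioms_def)
    ultimately obtain T where T: "henkin_theory T" "insert ?neq ?H \<subseteq> T"
      using henkin_extension by blast
    interpret desarguesian_theory T
      using T by (simp add: desarguesian_theory_def desarguesian_theory_axioms_def)
    have H: "?neq \<in> T" "?hyps \<in> T"
      using T by auto
    define p where "p = cls Pt"
    define q where "q = cls Ln"
    have "harm (p ''A'') (p ''B'') (p ''C'') (q ''ab'') (q ''l'') (p ''R'') (q ''br'') (q ''ar'')
        (p ''P'') (p ''Q'') (q ''ap'') (q ''bq'') (p ''S'') (q ''rs'') (p ''D'')"
      "harm (p ''A'') (p ''B'') (p ''C'') (q ''ab'') (q ''l1'') (p ''R1'') (q ''br1'') (q ''ar1'')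
        (p ''P1'') (p ''Q1'') (q ''ap1'') (q ''bq1'') (p ''S1'') (q ''rs1'') (p ''D1'')"
      using H(2) unfolding harm_def p_def q_def
      by (simp_all add: auxiliary_def harmonic_construction_def joins_def meets_def outside_def
          outside_in Neq_in)
    then have "p ''D'' = p ''D1''"
      by (rule harm_unique)
    then show False
      using H(1) by (simp add: Neq_in p_def)
  qed
  then have "?H \<turnstile> \<^bold>\<not> ?neq"
    by (rule ImpI)
  \<comment> \<open>Tightness is applied inside the calculus, at the names of \<open>D\<close> and
    \<open>D1\<close>.\<close>
  moreover have "?H \<turnstile> \<^bold>\<not> ?neq \<^bold>\<longrightarrow> ''D'' \<^bold>=[Pt] ''D1''"
  proof -
    have "?H \<turnstile> (\<^bold>\<forall>[Pt] [''x'', ''y'']. \<^bold>\<not> (''x'' \<^bold>\<noteq>[Pt] ''y'') \<^bold>\<longrightarrow> ''x'' \<^bold>=[Pt] ''y'')"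
      by (rule Asm) (simp add: Desarguesian_plane_def inequality_axioms_def)
    then have "?H \<turnstile> All Pt (All Pt (Imp (Imp (Neq Pt (Bd 1) (Bd 0)) Falsum) (Eq Pt (Bd 1) (Bd 0))))"
      by (simp add: all_names_def bind_name_def)
    from AllE[OF this, of "''D''"]
    have "?H \<turnstile> All Pt (Imp (Imp (Neq Pt (Fr ''D'') (Bd 0)) Falsum) (Eq Pt (Fr ''D'') (Bd 0)))"
      by (simp add: inst_def)
    from AllE[OF this, of "''D1''"] show ?thesis
      by (simp add: inst_def)
  qed
  ultimately have "?H \<turnstile> ''D'' \<^bold>=[Pt] ''D1''"
    by (rule ImpE[rotated])
  then have *: "?G \<turnstile> ?hyps \<^bold>\<longrightarrow> ''D'' \<^bold>=[Pt] ''D1''"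
    by (rule ImpI)
  have lc: "lc 0 (?hyps \<^bold>\<longrightarrow> ''D'' \<^bold>=[Pt] ''D1'')"
    by (simp add: auxiliary_def harmonic_construction_def joins_def meets_def outside_def)
  \<comment> \<open>All axioms are sentences, so any name may be generalised; the line names are
    bound first, then the point names.\<close>
  have "\<Union> (names ` ?G) = {}"
    by (simp add: Desarguesian_plane_def inequality_axioms_def names_all_names names_ex_names
        C1_def C2_def C3_def C4_def C5_def C6_def C7_def Desargues_def
        eight_lines_through_each_point_def outside_def joins_def meets_def Defs.triangle_def
        Diff_subset_conv)
  then have fresh: "x \<notin> \<Union> (names ` ?G)" for x
    by blast
  show ?thesis
    by (rule all_namesI[OF all_namesI[OF * lc fresh] lc_all_names[OF lc] fresh])
qed

end
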